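(* Up to isomorphism, the noncompletable six-vertex digraphs with exactly eight arcs are the following five digraphs (five distinct isomorphism classes): $$\overleftrightarrow{K}_3\mathbin{\dot\cup}\overrightarrow{P}_3,\quad \overleftrightarrow{K}_3\mathbin{\dot\cup}\overrightarrow{V}_3,\quad \overleftrightarrow{K}_3\mathbin{\dot\cup}\overrightarrow{\Lambda}_3,\quad \overleftrightarrow{K}_2\mathbin{\dot\cup}T_4^+,\quad \overleftrightarrow{K}_2\mathbin{\dot\cup}T_4^-.$$ On a fixed labelled six-element vertex set there are exactly $480$ noncompletable digraphs with eight arcs. Every one of the five digraphs is arc-minimal, and the list reduces to exactly three classes when each digraph is identified with its converse.
   Context: All digraphs are finite and loopless; opposite arcs $(u,v)$ and $(v,u)$ may both be present, but repeated arcs are not allowed. The complement $\overline D$ of a digraph $D$ has the same vertex set as $D$, and an ordered pair of distinct vertices is an arc of $\overline D$ exactly when it is not an arc of $D$. A digraph is self-complementary if it is isomorphic to its complement. An $n$-vertex digraph $D$ is completable if it is isomorphic to a spanning subdigraph of some self-complementary digraph of the same order $n$. A noncompletable digraph is arc-minimal if deleting any one arc (keeping all vertices) yields a completable digraph. The converse of a digraph is obtained by reversing all arcs. Notation: $\dot\cup$ denotes disjoint union of digraphs, with no arcs between the two parts. $\overleftrightarrow{K}_m$ is the digraph on $m$ vertices with all $m(m-1)$ ordered pairs of distinct vertices as arcs. On three vertices $x,y,z$: $\overrightarrow{P}_3$ has arc set $\{(x,y),(y,z)\}$; $\overrightarrow{V}_3$ has arc set $\{(y,x),(y,z)\}$ (central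 source); $\overrightarrow{\Lambda}_3$ has arc set $\{(x,y),(z,y)\}$ (central sink). $T_4^+$ is the four-vertex digraph obtained from a directed triangle $a\to b\to c\to a$ by adding a vertex $w$ with arcs $(w,a),(w,b),(w,c)$; $T_4^-$ is the converse of $T_4^+$. *)

theory Defs
  imports "Graph_Theory.Digraph_Isomorphism"
begin

text \<open>
  A finite loopless digraph without repeated arcs is a \<^typ>\<open>'a pair_pre_digraph\<close> that
  satisfies \<^const>\<open>pair_digraph\<close>; its arc set is a set of ordered pairs of vertices.
  Isomorphism, subdigraph and spanning subdigraph are the library notions, applied through
  the embedding \<^const>\<open>with_proj\<close>.
\<close>

abbreviation isomorphic ::
    "'a pair_pre_digraph \<Rightarrow> 'b pair_pre_digraph \<Rightarrow> bool" (infix \<open>\<simeq>\<close> 50) where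
  "D \<simeq> E \<equiv> digraph_iso (with_proj D) (with_proj E)"

definition complement :: "'a pair_pre_digraph \<Rightarrow> 'a pair_pre_digraph" where
  "complement D = \<lparr> pverts = pverts D,
     parcs = {(u, v). u \<in> pverts D \<and> v \<in> pverts D \<and> u \<noteq> v \<and> (u, v) \<notin> parcs D} \<rparr>"

definition self_complementary :: "'a pair_pre_digraph \<Rightarrow> bool" where
  "self_complementary D \<longleftrightarrow> D \<simeq> complement D"

text \<open>
  Taking \<open>S\<close> over the vertex type of \<open>D\<close> is no restriction: a self-complementary digraph
  of the same order over any other type has an isomorphic copy on the vertex set of \<open>D\<close>.
\<close>

definition completable :: "'a pair_pre_digraph \<Rightarrow> bool" where
  "completable D \<longleftrightarrow>
     (\<exists>S H :: 'a pair_pre_digraph.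
        pair_digraph S \<and> card (pverts S) = card (pverts D) \<and> self_complementary S \<and>
        spanning (with_proj H) (with_proj S) \<and> D \<simeq> H)"

definition delete_arc :: "'a pair_pre_digraph \<Rightarrow> 'a \<times> 'a \<Rightarrow> 'a pair_pre_digraph" where
  "delete_arc D a = \<lparr> pverts = pverts D, parcs = parcs D - {a} \<rparr>"

definition arc_minimal :: "'a pair_pre_digraph \<Rightarrow> bool" where
  "arc_minimal D \<longleftrightarrow> \<not> completable D \<and> (\<forall>a \<in> parcs D. completable (delete_arc D a))"

definition reverse :: "'a pair_pre_digraph \<Rightarrow> 'a pair_pre_digraph" where
  "reverse D = \<lparr> pverts = pverts D, parcs = (parcs D)\<inverse> \<rparr>"

definition disjoint_union ::
    "'a pair_pre_digraph \<Rightarrow> 'b pair_pre_digraph \<Rightarrow> ('a + 'b) pair_pre_digraph"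
    (infixl \<open>\<uplus>\<close> 65) where
  "D \<uplus> E = \<lparr> pverts = pverts D <+> pverts E,
     parcs = map_prod Inl Inl ` parcs D \<union> map_prod Inr Inr ` parcs E \<rparr>"

definition complete_dg :: "nat \<Rightarrow> nat pair_pre_digraph" where
  "complete_dg m = \<lparr> pverts = {..<m}, parcs = {(u, v). u < m \<and> v < m \<and> u \<noteq> v} \<rparr>"

text \<open>The vertices \<open>x, y, z\<close> are \<open>0, 1, 2\<close>.\<close>

definition P3 :: "nat pair_pre_digraph" where
  "P3 = \<lparr> pverts = {0, 1, 2}, parcs = {(0, 1), (1, 2)} \<rparr>"

definition V3 :: "nat pair_pre_digraph" where
  "V3 = \<lparr> pverts = {0, 1, 2}, parcs = {(1, 0), (1, 2)} \<rparr>"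

definition Lambda3 :: "nat pair_pre_digraph" where
  "Lambda3 = \<lparr> pverts = {0, 1, 2}, parcs = {(0, 1), (2, 1)} \<rparr>"

text \<open>The directed triangle \<open>a, b, c\<close> is \<open>0, 1, 2\<close>, and the added vertex \<open>w\<close> is \<open>3\<close>.\<close>

definition T4_plus :: "nat pair_pre_digraph" where
  "T4_plus = \<lparr> pverts = {0, 1, 2, 3},
     parcs = {(0, 1), (1, 2), (2, 0), (3, 0), (3, 1), (3, 2)} \<rparr>"

definition T4_minus :: "nat pair_pre_digraph" where
  "T4_minus = reverse T4_plus"

definition five_digraphs :: "(nat + nat) pair_pre_digraph set" where
  "five_digraphs =
     {complete_dg 3 \<uplus> P3, complete_dg 3 \<uplus> V3, complete_dg 3 \<uplus> Lambda3,
      complete_dg 2 \<uplus> T4_plus, complete_dg 2 \<uplus> T4_minus}"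

text \<open>
  Identifying every digraph with its isomorphic copies and with its converse. The lemma
  below shows that no closure has to be taken, so that the quotient by this relation
  consists of genuine classes.
\<close>

definition iso_or_converse :: "('a pair_pre_digraph \<times> 'a pair_pre_digraph) set" where
  "iso_or_converse =
     {(D, E). pair_digraph D \<and> pair_digraph E \<and> (D \<simeq> E \<or> D \<simeq> reverse E)}"

lemma reverse_reverse [simp]: "reverse (reverse D) = D"
  by (simp add: reverse_def)

lemma isomorphicI:
  assumes "pair_wf_digraph D" "inj_on f (pverts D)"
    and "pverts E = f ` pverts D" "parcs E = map_prod f f ` parcs D"
  shows "D \<simeq> E"
proof -
  let ?h = "\<lparr> iso_verts = f, iso_arcs = map_prod f f, iso_head = snd, iso_tail = fst \<rparr>"
  have sub: "parcs D \<subseteq> pverts D \<times> pverts D"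
    using pair_wf_digraph.in_arcsD1[OF assms(1)] pair_wf_digraph.in_arcsD2[OF assms(1)] by auto
  have "inj_on (map_prod f f) (parcs D)"
    by (rule inj_on_subset[OF map_prod_inj_on[OF assms(2) assms(2)] sub])
  then have "pre_digraph.digraph_isomorphism (with_proj D) ?h"
    using assms(1,2) by (simp add: pre_digraph.digraph_isomorphism_def wf_digraph_wp_iff)
  moreover have "with_proj E = app_iso ?h (with_proj D)"
    using assms(3,4) by (simp add: with_proj_def app_iso_def)
  ultimately show ?thesis
    unfolding digraph_iso_def by blast
qed

lemma isomorphicE:
  assumes "D \<simeq> E"
  obtains f where "pair_wf_digraph D" "inj_on f (pverts D)"
    "pverts E = f ` pverts D" "parcs E = map_prod f f ` parcs D"
proof -
  obtain h where h: "pre_digraph.digraph_isomorphism (with_proj D) h"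
    and E: "with_proj E = app_iso h (with_proj D)"
    using assms unfolding digraph_iso_def by blast
  from E have proj: "iso_tail h = fst" "iso_head h = snd"
    and V: "pverts E = iso_verts h ` pverts D" and A: "parcs E = iso_arcs h ` parcs D"
    by (auto simp: with_proj_def app_iso_def)
  have "iso_arcs h e = map_prod (iso_verts h) (iso_verts h) e" if "e \<in> parcs D" for e
    using h proj that
    by (cases e) (auto simp: pre_digraph.digraph_isomorphism_def prod_eq_iff)
  then have "parcs E = map_prod (iso_verts h) (iso_verts h) ` parcs D"
    using A by simp
  then show thesis
    using that[of "iso_verts h"] h V
    by (simp add: pre_digraph.digraph_isomorphism_def wf_digraph_wp_iff)
qed

lemma pair_wf_digraph_reverse:
  assumes "pair_wf_digraph D" shows "pair_wf_digraph (reverse D)"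
  using pair_wf_digraph.in_arcsD1[OF assms] pair_wf_digraph.in_arcsD2[OF assms]
  by unfold_locales (auto simp: reverse_def)

lemma iso_refl:
  assumes "pair_digraph D" shows "D \<simeq> D"
proof (rule isomorphicI[where f = "\<lambda>x. x"])
  show "pair_wf_digraph D" by (rule pair_digraph.pair_wf_digraph[OF assms])
qed (auto simp: map_prod_def)

lemma iso_reverse:
  assumes "D \<simeq> E" shows "reverse D \<simeq> reverse E"
  using assms
proof (rule isomorphicE)
  fix f
  assume f: "pair_wf_digraph D" "inj_on f (pverts D)"
    "pverts E = f ` pverts D" "parcs E = map_prod f f ` parcs D"
  show ?thesis
    by (rule isomorphicI[where f = f])
      (use f pair_wf_digraph_reverse[OF f(1)] in \<open>auto simp: reverse_def\<close>)
qed

lemma iso_sym: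
  assumes "D \<simeq> E" shows "E \<simeq> D"
proof -
  have "wf_digraph (with_proj D)"
    using assms by (rule isomorphicE) (simp add: wf_digraph_wp_iff)
  then show ?thesis using assms by (rule digraph_iso_swap)
qed

lemma equiv_iso_or_converse:
  "equiv {D. pair_digraph D} iso_or_converse"
proof (rule equivI)
  show "iso_or_converse \<subseteq> {D. pair_digraph D} \<times> {D. pair_digraph D}"
    by (auto simp: iso_or_converse_def)
  show "refl_on {D. pair_digraph D} iso_or_converse"
    by (auto simp: refl_on_def iso_or_converse_def iso_refl)
  show "sym iso_or_converse"
    using iso_reverse iso_sym by (fastforce simp: sym_def iso_or_converse_def)
  show "trans iso_or_converse"
  proof (rule transI)
    fix D E F
    assume "(D, E) \<in> iso_or_converse" "(E, F) \<in> iso_or_converse"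
    then have dg: "pair_digraph D" "pair_digraph F"
      and "D \<simeq> E \<or> D \<simeq> reverse E" "E \<simeq> F \<or> E \<simeq> reverse F"
      by (auto simp: iso_or_converse_def)
    moreover have "reverse E \<simeq> reverse F \<or> reverse E \<simeq> F" if "E \<simeq> F \<or> E \<simeq> reverse F"
      using that iso_reverse[of E F] iso_reverse[of E "reverse F"] by auto
    ultimately have "D \<simeq> F \<or> D \<simeq> reverse F"
      by (meson digraph_iso_trans)
    with dg show "(D, F) \<in> iso_or_converse" by (simp add: iso_or_converse_def)
  qed
qed

end

theory Submission
  imports Defs "HOL-Combinatorics.Permutations"
begin

text \<open>
  A digraph on six vertices is completable as soon as some fixed-point-free permutation \<open>s\<close>
  with \<open>s\<^sup>4 = 1\<close> maps none of its arcs to one of its arcs. So a noncompletable digraph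
  contains, for each of the 105 permutations \<open>s\<close> of this kind, an arc together with its image
  under \<open>s\<close>. The sets of eight arcs meeting these 105 conditions are found by branching on the
  arcs, pruned by symmetry and evaluated by the simplifier; they are the labelled copies of the
  five digraphs. That these five are noncompletable is checked against all 720 permutations: an
  odd power of an antimorphism neither fixes an arc nor maps an arc of the digraph to another
  one. Orbit counting then yields \<open>720 / 6 + 720 / 12 + 720 / 12 + 720 / 6 + 720 / 6 = 480\<close>.
\<close>

section \<open>Digraphs on a six-element vertex type\<close>

datatype vert = U0 | U1 | U2 | U3 | U4 | U5

text \<open>Functions on \<open>vert\<close> are stored by their values, so that rewriting can
  enumerate permutations and look up matrix entries as plain data.\<close>

datatype 'a six = Six 'a 'a 'a 'a 'a 'a

fun ap :: "'a six \<Rightarrow> vert \<Rightarrow> 'a" where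
  "ap (Six a b c d e f) U0 = a"
| "ap (Six a b c d e f) U1 = b"
| "ap (Six a b c d e f) U2 = c"
| "ap (Six a b c d e f) U3 = d"
| "ap (Six a b c d e f) U4 = e"
| "ap (Six a b c d e f) U5 = f"

lemma UNIV_vert: "UNIV = {U0, U1, U2, U3, U4, U5}"
  using vert.exhaust by auto

instance vert :: finite
  by standard (simp add: UNIV_vert)

lemma card_vert: "card (UNIV :: vert set) = 6"
  by (simp add: UNIV_vert)

lemma all_vert: "(\<forall>v. P v) \<longleftrightarrow> P U0 \<and> P U1 \<and> P U2 \<and> P U3 \<and> P U4 \<and> P U5"
  by (metis vert.exhaust)

lemma ap_inject: "ap s = ap t \<longleftrightarrow> s = t"
  by (cases s; cases t) (simp add: fun_eq_iff all_vert)

lemma ap_surj: "\<exists>s. f = ap s"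
  by (rule exI[of _ "Six (f U0) (f U1) (f U2) (f U3) (f U4) (f U5)"])
     (simp add: fun_eq_iff all_vert)

section \<open>Permutations of the six vertices as explicit tuples\<close>

definition verts_list :: "vert list" where
  "verts_list = [U0, U1, U2, U3, U4, U5]"

definition arcs_list :: "(vert \<times> vert) list" where
  "arcs_list = [(u, v). u \<leftarrow> verts_list, v \<leftarrow> verts_list, u \<noteq> v]"

lemma set_verts_list: "set verts_list = UNIV"
  by (simp add: verts_list_def UNIV_vert)

lemma set_arcs_list: "set arcs_list = {(u, v). u \<noteq> v}"
  by (auto simp: arcs_list_def set_verts_list)

text \<open>The images \<open>a\<close>, \<open>b\<close> of \<open>U0\<close>, \<open>U1\<close>
  are parameters so that an embedding test can run through just the 24 permutations with a
  prescribed image of one arc.\<close>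

definition perms_from :: "vert \<Rightarrow> vert \<Rightarrow> vert six list" where
  "perms_from a b = [Six a b c d e f. c \<leftarrow> filter (\<lambda>c. c \<notin> set [a, b]) verts_list,
     d \<leftarrow> filter (\<lambda>d. d \<notin> set [a, b, c]) verts_list,
     e \<leftarrow> filter (\<lambda>e. e \<notin> set [a, b, c, d]) verts_list,
     f \<leftarrow> filter (\<lambda>f. f \<notin> set [a, b, c, d, e]) verts_list]"

definition perms :: "vert six list" where
  "perms = [s. (a, b) \<leftarrow> arcs_list, s \<leftarrow> perms_from a b]"

lemma perms_iff: "s \<in> set perms \<longleftrightarrow> bij (ap s)"
proof (cases s)
  case (Six a b c d e f)
  have "s \<in> set perms \<longleftrightarrow> distinct [a, b, c, d, e, f]"
    unfolding Six perms_def perms_from_def by (auto simp: set_verts_list set_arcs_list image_iff)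
  also have "\<dots> \<longleftrightarrow> inj (ap s)"
    unfolding Six inj_def all_vert by auto
  also have "\<dots> \<longleftrightarrow> bij (ap s)"
    using finite_UNIV_inj_surj[of "ap s"] by (auto simp: bij_def)
  finally show ?thesis .
qed

lemma bij_iff_perms: "bij p \<longleftrightarrow> (\<exists>s \<in> set perms. p = ap s)"
  using ap_surj[of p] by (auto simp: perms_iff)

section \<open>Relabelled arc sets and their copies on other vertex types\<close>

definition act :: "(vert \<Rightarrow> vert) \<Rightarrow> vert rel \<Rightarrow> vert rel" where
  "act p A = map_prod p p ` A"

lemma act_comp: "act p (act q A) = act (p \<circ> q) A"
  by (simp add: act_def image_image map_prod_def split_def)

lemma act_id: "act id A = A"
  by (simp add: act_def map_prod_def)

lemma act_mem: "bij p \<Longrightarrow> (p u, p v) \<in> act p A \<longleftrightarrow> (u, v) \<in> A"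
  by (auto simp: act_def bij_def inj_eq)

lemma act_inv: "bij p \<Longrightarrow> act (inv p) (act p A) = A" "bij p \<Longrightarrow> act p (act (inv p) A) = A"
  using bij_is_inj[of p] bij_is_surj[of p] by (simp_all add: act_comp act_id surj_iff)

lemma card_act: "bij p \<Longrightarrow> card (act p A) = card A"
  unfolding act_def by (intro card_image inj_on_subset[OF prod.inj_map]) (auto simp: bij_def)

lemma irrefl_act: "bij p \<Longrightarrow> irrefl (act p A) \<longleftrightarrow> irrefl A"
  by (auto simp: act_def irrefl_def bij_def inj_eq)

text \<open>For injective \<open>h\<close> and irreflexive \<open>A\<close> these are all loopless
  digraphs on \<open>range h\<close>, so questions about them become computations with relations on
  \<open>vert\<close>.\<close>

definition copy :: "(vert \<Rightarrow> 'a) \<Rightarrow> vert rel \<Rightarrow> 'a pair_pre_digraph" where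
  "copy h A = \<lparr> pverts = range h, parcs = map_prod h h ` A \<rparr>"

lemma copy_simps [simp]: "pverts (copy h A) = range h" "parcs (copy h A) = map_prod h h ` A"
  by (simp_all add: copy_def)

lemma copy_eqI: "pverts D = range h \<Longrightarrow> parcs D = map_prod h h ` A \<Longrightarrow> D = copy h A"
  by (cases D) (simp add: copy_def)

lemma copy_inject: "inj h \<Longrightarrow> copy h A = copy h B \<longleftrightarrow> A = B"
  by (simp add: copy_def inj_image_eq_iff prod.inj_map)

lemma pair_digraph_copy:
  assumes "inj h" "irrefl A"
  shows "pair_digraph (copy h A)"
  using assms by unfold_locales (auto simp: irrefl_def inj_eq)

lemma card_copy:
  assumes "inj h"
  shows "card (pverts (copy h A)) = 6" "card (parcs (copy h A)) = card A"
  using assms by (simp_all add: card_image card_vert inj_on_subset[OF prod.inj_map])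

lemma copy_exists:
  assumes D: "pair_digraph D" and h: "inj h" "range h = pverts D"
  obtains A where "irrefl A" "D = copy h A"
proof
  interpret pair_digraph D by (rule D)
  let ?A = "{(u, v). (h u, h v) \<in> parcs D}"
  show "irrefl ?A"
    using pair_no_loops by (fastforce simp: irrefl_def)
  have "parcs D \<subseteq> range h \<times> range h"
    using in_arcsD1 in_arcsD2 h(2) by auto
  then have "parcs D = map_prod h h ` ?A"
    by (auto simp: image_iff map_prod_def split: prod.splits)
  then show "D = copy h ?A"
    using h by (intro copy_eqI) simp_all
qed

lemma frame_exists:
  assumes "card V = 6"
  obtains h :: "vert \<Rightarrow> 'a" where "inj h" "range h = V"
proof -
  have "finite V"
    using assms card.infinite by fastforce
  then obtain h where "bij_betw h (UNIV :: vert set) V"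
    using assms card_vert by (metis finite bij_betw_iff_card)
  then show thesis
    using that by (auto simp: bij_betw_def)
qed

text \<open>An isomorphism \<open>f\<close> induces the permutation
  \<open>inv k \<circ> f \<circ> h\<close>, and a permutation \<open>p\<close> induces the
  isomorphism \<open>k \<circ> p \<circ> inv h\<close>.\<close>

lemma copy_iso_iff:
  fixes h :: "vert \<Rightarrow> 'a" and k :: "vert \<Rightarrow> 'b"
  assumes h: "inj h" and k: "inj k" and A: "irrefl A"
  shows "copy h A \<simeq> copy k B \<longleftrightarrow> (\<exists>p. bij p \<and> B = act p A)"
proof
  assume "copy h A \<simeq> copy k B"
  then obtain f where f: "inj_on f (range h)" "range k = f ` range h"
    "map_prod k k ` B = map_prod f f ` map_prod h h ` A"
    by (rule isomorphicE) auto
  define p where "p = inv k \<circ> f \<circ> h"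
  have kp: "k (p v) = f (h v)" for v
    unfolding p_def o_apply by (rule f_inv_into_f) (use f(2) in auto)
  have "inj p"
    by (rule injI) (metis kp f(1) h inj_eq inj_onD rangeI)
  then have "bij p"
    by (simp add: bij_def finite_UNIV_inj_surj)
  moreover have "map_prod k k ` B = map_prod k k ` act p A"
    unfolding f(3) act_def image_image by (simp add: map_prod_def kp split_def)
  then have "B = act p A"
    using prod.inj_map[OF k k] by (simp add: inj_image_eq_iff)
  ultimately show "\<exists>p. bij p \<and> B = act p A" by blast
next
  assume "\<exists>p. bij p \<and> B = act p A"
  then obtain p where p: "bij p" "B = act p A" by blast
  have kp: "(k \<circ> p \<circ> inv h) (h v) = k (p v)" for v
    using h by simp
  show "copy h A \<simeq> copy k B"
  proof (rule isomorphicI[where f = "k \<circ> p \<circ> inv h"])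
    show "pair_wf_digraph (copy h A)"
      by (rule pair_digraph.pair_wf_digraph[OF pair_digraph_copy[OF h A]])
    show "inj_on (k \<circ> p \<circ> inv h) (pverts (copy h A))"
      by (auto intro!: inj_onI simp: h inj_eq[OF k] inj_eq[OF bij_is_inj[OF p(1)]])
    show "pverts (copy k B) = (k \<circ> p \<circ> inv h) ` pverts (copy h A)"
      using bij_is_surj[OF p(1)] h by (auto simp: image_image) (metis surjD rangeI)
    show "parcs (copy k B) = map_prod (k \<circ> p \<circ> inv h) (k \<circ> p \<circ> inv h) ` parcs (copy h A)"
      unfolding p(2) act_def using h by (simp add: image_image map_prod_def split_def)
  qed
qed

section \<open>Antimorphisms and completability\<close>

definition antimorphism :: "(vert \<Rightarrow> vert) \<Rightarrow> vert rel \<Rightarrow> bool" where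
  "antimorphism \<sigma> S \<longleftrightarrow> bij \<sigma> \<and>
     (\<forall>u v. u \<noteq> v \<longrightarrow> ((\<sigma> u, \<sigma> v) \<in> S \<longleftrightarrow> (u, v) \<notin> S))"

text \<open>Completability read on labelled arc sets: an antimorphism of an irreflexive
  \<open>S\<close> is an isomorphism from its digraph onto the complement.\<close>

definition extendable :: "vert rel \<Rightarrow> bool" where
  "extendable A \<longleftrightarrow> (\<exists>\<sigma> S. irrefl S \<and> A \<subseteq> S \<and> antimorphism \<sigma> S)"

lemma complement_copy: "inj h \<Longrightarrow> complement (copy h S) = copy h {(u, v). u \<noteq> v \<and> (u, v) \<notin> S}"
  by (rule copy_eqI) (auto simp: complement_def inj_eq)

lemma self_complementary_copy:
  assumes h: "inj h" and S: "irrefl S"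
  shows "self_complementary (copy h S) \<longleftrightarrow> (\<exists>\<sigma>. antimorphism \<sigma> S)"
proof -
  have key: "{(u, v). u \<noteq> v \<and> (u, v) \<notin> S} = act \<sigma> S \<longleftrightarrow> antimorphism \<sigma> S" (is "?C = _ \<longleftrightarrow> _")
    if \<sigma>: "bij \<sigma>" for \<sigma>
  proof -
    \<comment> \<open>As \<sigma> is surjective, the two arc sets may be compared at image pairs
      only, where membership in \<open>act \<sigma> S\<close> becomes membership in
      \<open>S\<close>.\<close>
    have all: "(\<forall>x y. P x y) \<longleftrightarrow> (\<forall>u v. P (\<sigma> u) (\<sigma> v))" for P
      using bij_is_surj[OF \<sigma>] by (metis surjD)
    have "?C = act \<sigma> S \<longleftrightarrow> (\<forall>x y. (x, y) \<in> ?C \<longleftrightarrow> (x, y) \<in> act \<sigma> S)"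
      by (simp only: set_eq_iff split_paired_All)
    also have "\<dots> \<longleftrightarrow> (\<forall>u v. (\<sigma> u, \<sigma> v) \<in> ?C \<longleftrightarrow> (u, v) \<in> S)"
      by (subst all) (simp only: act_mem[OF \<sigma>])
    also have "\<dots> \<longleftrightarrow> antimorphism \<sigma> S"
      using \<sigma> S by (simp add: antimorphism_def inj_eq[OF bij_is_inj[OF \<sigma>]] irrefl_def) metis
    finally show ?thesis .
  qed
  then show ?thesis
    unfolding self_complementary_def complement_copy[OF h] copy_iso_iff[OF h h S]
    by (meson antimorphism_def)
qed

lemma completable_copy:
  fixes h :: "vert \<Rightarrow> 'a"
  assumes h: "inj h" and A: "irrefl A"
  shows "completable (copy h A) \<longleftrightarrow> extendable A"
proof
  assume "extendable A"
  then obtain \<sigma> S where S: "irrefl S" "A \<subseteq> S" "antimorphism \<sigma> S"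
    by (auto simp: extendable_def)
  have "spanning (with_proj (copy h A)) (with_proj (copy h S))"
    unfolding spanning_def subgraph_def compatible_def
    using S(2) pair_digraph.pair_wf_digraph[OF pair_digraph_copy[OF h A]]
      pair_digraph.pair_wf_digraph[OF pair_digraph_copy[OF h S(1)]]
    by (auto simp: wf_digraph_wp_iff)
  then show "completable (copy h A)"
    unfolding completable_def
    using pair_digraph_copy[OF h S(1)] self_complementary_copy[OF h S(1)] S(3)
      iso_refl[OF pair_digraph_copy[OF h A]]
    by (intro exI[of _ "copy h S"] exI[of _ "copy h A"]) auto
next
  assume "completable (copy h A)"
  then obtain S H :: "'a pair_pre_digraph" where S: "pair_digraph S" "self_complementary S"
    and H: "spanning (with_proj H) (with_proj S)" and iso: "copy h A \<simeq> H"
    by (auto simp: completable_def)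
  from iso obtain f where f: "inj_on f (range h)" "pverts H = f ` range h"
    "parcs H = map_prod f f ` map_prod h h ` A"
    by (rule isomorphicE) auto
  \<comment> \<open>The isomorphism \<open>f\<close> carries the labelling \<open>h\<close> over to
    the vertices of the host \<open>S\<close>; in this labelling the embedded copy has arc set
    \<open>A\<close> itself.\<close>
  have k: "inj (f \<circ> h)"
    using h f(1) by (rule comp_inj_on)
  have "range (f \<circ> h) = pverts S"
    using H f(2) by (auto simp: spanning_def)
  then obtain T where T: "irrefl T" "S = copy (f \<circ> h) T"
    using copy_exists[OF S(1) k] by blast
  have "map_prod f f ` map_prod h h ` A = map_prod (f \<circ> h) (f \<circ> h) ` A"
    by (simp add: image_image map_prod_def split_def)
  then have "map_prod (f \<circ> h) (f \<circ> h) ` A \<subseteq> map_prod (f \<circ> h) (f \<circ> h) ` T"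
    using H f(3) T(2) by (simp add: spanning_def subgraph_def)
  then have "A \<subseteq> T"
    using prod.inj_map[OF k k] by (simp add: inj_image_subset_iff)
  then show "extendable A"
    using T S(2) self_complementary_copy[OF k T(1)] by (auto simp: extendable_def)
qed

section \<open>A sufficient criterion for extendability\<close>

definition conflict_free :: "(vert \<Rightarrow> vert) \<Rightarrow> vert rel \<Rightarrow> bool" where
  "conflict_free \<sigma> A \<longleftrightarrow> (\<forall>(u, v) \<in> A. (\<sigma> u, \<sigma> v) \<notin> A)"

text \<open>
  An inclusion-maximal conflict-free superset of \<open>A\<close> contains exactly every other arc of
  each orbit of \<open>\<sigma>\<close>, because the orbits have length 2 or 4.
\<close>

lemma extendable_if_conflict_free:
  assumes \<sigma>: "\<And>v. \<sigma> v \<noteq> v" "\<And>v. \<sigma> (\<sigma> (\<sigma> (\<sigma> v))) = v"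
    and A: "irrefl A" "conflict_free \<sigma> A"
  shows "extendable A"
proof -
  have inj: "\<sigma> u = \<sigma> v \<longleftrightarrow> u = v" for u v
    by (metis \<sigma>(2))
  have bij: "bij \<sigma>"
    using inj by (auto simp: bij_def inj_def finite_UNIV_inj_surj)
  let ?P = "\<lambda>S. irrefl S \<and> conflict_free \<sigma> S"
  obtain S where AS: "A \<subseteq> S" and S: "?P S" and max: "\<And>T. ?P T \<Longrightarrow> S \<subseteq> T \<Longrightarrow> S = T"
    using finite_has_maximal2[of "{S. ?P S}" A] A by auto
  \<comment> \<open>By maximality a missing arc clashes with its image or its preimage in
    \<open>S\<close>; it does not clash with itself, as \<sigma> moves \<open>u\<close>.\<close>
  have add: "(\<sigma> u, \<sigma> v) \<in> S \<or> (\<exists>x y. (x, y) \<in> S \<and> \<sigma> x = u \<and> \<sigma> y = v)"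
    if "u \<noteq> v" "(u, v) \<notin> S" for u v
  proof (rule ccontr)
    assume "\<not> ?thesis"
    then have "?P (insert (u, v) S)"
      using S that \<sigma>(1)[of u] by (auto simp: conflict_free_def irrefl_def)
    then show False
      using max[of "insert (u, v) S"] that by auto
  qed
  have free: "(\<sigma> u, \<sigma> v) \<notin> S" if "(u, v) \<in> S" for u v
    using S that by (auto simp: conflict_free_def)
  have "(\<sigma> u, \<sigma> v) \<in> S \<longleftrightarrow> (u, v) \<notin> S" if uv: "u \<noteq> v" for u v
  proof
    assume n: "(u, v) \<notin> S"
    show "(\<sigma> u, \<sigma> v) \<in> S"
    proof (rule ccontr)
      assume n': "(\<sigma> u, \<sigma> v) \<notin> S"
      with add[OF uv n] obtain x y where xy: "(x, y) \<in> S" "\<sigma> x = u" "\<sigma> y = v" by blast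
      \<comment> \<open>As \<open>(u, v)\<close> is missing, \<open>(\<sigma> u, \<sigma> v)\<close>
        can only clash with its image. Since \<sigma>^4 = 1, that image is in turn mapped to the arc
        \<open>(x, y)\<close> of \<open>S\<close>.\<close>
      have "(\<sigma> (\<sigma> u), \<sigma> (\<sigma> v)) \<in> S"
        using add[of "\<sigma> u" "\<sigma> v"] n n' uv by (auto simp: inj)
      moreover have "\<sigma> (\<sigma> (\<sigma> u)) = x" "\<sigma> (\<sigma> (\<sigma> v)) = y"
        using xy \<sigma>(2) by auto
      ultimately show False
        using free xy(1) by metis
    qed
  qed (use free in blast)
  then show ?thesis
    using S AS bij by (auto simp: extendable_def antimorphism_def)
qed

text \<open>Relabelling by \<open>q\<close> conjugates the antimorphism; the converse direction
  relabels by \<open>inv p\<close>.\<close>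

lemma extendable_act:
  assumes "bij p"
  shows "extendable (act p A) \<longleftrightarrow> extendable A"
proof -
  have *: "extendable (act q B)" if q: "bij q" and "extendable B" for q B
  proof -
    from that obtain \<sigma> S where S: "irrefl S" "B \<subseteq> S" "antimorphism \<sigma> S"
      by (auto simp: extendable_def)
    have "antimorphism (q \<circ> \<sigma> \<circ> inv q) (act q S)"
      unfolding antimorphism_def
    proof (intro conjI allI impI)
      show "bij (q \<circ> \<sigma> \<circ> inv q)"
        using q S(3) by (auto simp: antimorphism_def intro!: bij_comp bij_imp_bij_inv)
      fix u v :: vert
      assume "u \<noteq> v"
      then obtain x y where xy: "u = q x" "v = q y" "x \<noteq> y"
        using q by (metis bij_pointE)
      then show "((q \<circ> \<sigma> \<circ> inv q) u, (q \<circ> \<sigma> \<circ> inv q) v) \<in> act q S \<longleftrightarrow> (u, v) \<notin> act q S"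
        using S(3) q by (simp add: act_mem antimorphism_def bij_is_inj)
    qed
    then show ?thesis
      using S irrefl_act[OF q] unfolding extendable_def
      by (intro exI[of _ "q \<circ> \<sigma> \<circ> inv q"] exI[of _ "act q S"]) (auto simp: act_def)
  qed
  show ?thesis
    using *[OF assms, of A] *[OF bij_imp_bij_inv[OF assms], of "act p A"] act_inv[OF assms] by auto
qed

section \<open>Searching all arc sets of a given size\<close>

fun upd :: "'a six \<Rightarrow> vert \<Rightarrow> 'a \<Rightarrow> 'a six" where
  "upd (Six a b c d e f) U0 x = Six x b c d e f"
| "upd (Six a b c d e f) U1 x = Six a x c d e f"
| "upd (Six a b c d e f) U2 x = Six a b x d e f"
| "upd (Six a b c d e f) U3 x = Six a b c x e f"
| "upd (Six a b c d e f) U4 x = Six a b c d x f"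
| "upd (Six a b c d e f) U5 x = Six a b c d e x"

lemma ap_upd: "ap (upd s v x) = (ap s)(v := x)"
  by (cases s; cases v) (simp_all add: fun_eq_iff all_vert)

section \<open>Matrices of decided and undecided arcs\<close>

datatype status = In | Out | Free

fun is_In :: "status \<Rightarrow> bool" where
  "is_In In = True" | "is_In Out = False" | "is_In Free = False"

lemma is_In_iff: "is_In x \<longleftrightarrow> x = In"
  by (cases x) simp_all

type_synonym matrix = "status six six"

definition status :: "matrix \<Rightarrow> vert \<Rightarrow> vert \<Rightarrow> status" where
  "status M u v = ap (ap M u) v"

definition set_status :: "matrix \<Rightarrow> vert \<Rightarrow> vert \<Rightarrow> status \<Rightarrow> matrix" where
  "set_status M u v x = upd M u (upd (ap M u) v x)"

lemma status_set_status:
  "status (set_status M u v x) u' v' = (if u' = u \<and> v' = v then x else status M u' v')"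
  by (simp add: status_def set_status_def ap_upd)

definition const_matrix :: "status \<Rightarrow> matrix" where
  "const_matrix x = (let r = Six x x x x x x in Six r r r r r r)"

lemma status_const_matrix: "status (const_matrix x) u v = x"
  by (cases u; cases v) (simp_all add: status_def const_matrix_def Let_def)

fun set_all :: "status \<Rightarrow> (vert \<times> vert) list \<Rightarrow> matrix \<Rightarrow> matrix" where
  "set_all x [] M = M"
| "set_all x ((u, v) # es) M = set_all x es (set_status M u v x)"

lemma status_set_all:
  "status (set_all x es M) u v = (if (u, v) \<in> set es then x else status M u v)"
  by (induction x es M rule: set_all.induct) (auto simp: status_set_status)

definition matrix :: "(vert \<times> vert) list \<Rightarrow> matrix" where
  "matrix A = set_all In A (const_matrix Out)"

lemma status_matrix: "status (matrix A) u v = In \<longleftrightarrow> (u, v) \<in> set A"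
  by (simp add: matrix_def status_set_all status_const_matrix)

fun hit :: "vert six \<Rightarrow> matrix \<Rightarrow> (vert \<times> vert) list \<Rightarrow> bool" where
  "hit s M [] = False"
| "hit s M ((u, v) # es) = (is_In (status M (ap s u) (ap s v)) \<or> hit s M es)"

lemma hit_iff: "hit s M es \<longleftrightarrow> (\<exists>(u, v) \<in> set es. status M (ap s u) (ap s v) = In)"
  by (induction s M es rule: hit.induct) (auto simp: is_In_iff)

lemma conflict_free_if_not_hit:
  "\<not> hit s (matrix A) A \<Longrightarrow> conflict_free (ap s) (set A)"
  by (auto simp: hit_iff conflict_free_def status_matrix)

section \<open>Embeddings between arc lists\<close>

fun maps_into :: "vert six \<Rightarrow> matrix \<Rightarrow> (vert \<times> vert) list \<Rightarrow> bool" where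
  "maps_into s M [] = True"
| "maps_into s M ((u, v) # es) = (is_In (status M (ap s u) (ap s v)) \<and> maps_into s M es)"

lemma maps_into_matrix: "maps_into s (matrix A) B \<longleftrightarrow> act (ap s) (set B) \<subseteq> set A"
proof (induction B)
  case (Cons e B)
  then show ?case
    by (cases e) (simp add: is_In_iff status_matrix act_def)
qed (simp add: act_def)

fun some_maps_into :: "vert six list \<Rightarrow> matrix \<Rightarrow> (vert \<times> vert) list \<Rightarrow> bool" where
  "some_maps_into [] M es = False"
| "some_maps_into (s # ss) M es = (maps_into s M es \<or> some_maps_into ss M es)"

lemma some_maps_into_iff: "some_maps_into ss M es \<longleftrightarrow> (\<exists>s \<in> set ss. maps_into s M es)"
  by (induction ss) simp_all

text \<open>
  In all digraphs \<open>A\<close> to be embedded, \<open>U0\<close> and \<open>U1\<close> span a 2-cycle, so that only the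
  2-cycles of \<open>B\<close> have to be considered as its image.
\<close>

definition embeds :: "(vert \<times> vert) list \<Rightarrow> (vert \<times> vert) list \<Rightarrow> bool" where
  "embeds A B \<longleftrightarrow> list_ex (\<lambda>(a, b). is_In (status (matrix B) a b) \<and> is_In (status (matrix B) b a) \<and>
     some_maps_into (perms_from a b) (matrix B) A) arcs_list"

lemma perms_from_ap: "s \<in> set (perms_from a b) \<Longrightarrow> ap s U0 = a \<and> ap s U1 = b"
  by (auto simp: perms_from_def)

lemma embeds_iff:
  assumes "(U0, U1) \<in> set A" "(U1, U0) \<in> set A"
  shows "embeds A B \<longleftrightarrow> (\<exists>p. bij p \<and> act p (set A) \<subseteq> set B)"
proof -
  have "(a, b) \<in> set B \<and> (b, a) \<in> set B"
    if "s \<in> set (perms_from a b)" "act (ap s) (set A) \<subseteq> set B" for s a b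
    using that(2) imageI[OF assms(1), of "map_prod (ap s) (ap s)"]
      imageI[OF assms(2), of "map_prod (ap s) (ap s)"] perms_from_ap[OF that(1)]
    by (auto simp: act_def)
  then have "embeds A B \<longleftrightarrow> (\<exists>s \<in> set perms. act (ap s) (set A) \<subseteq> set B)"
    by (auto simp: embeds_def list_ex_iff is_In_iff status_matrix some_maps_into_iff
        maps_into_matrix perms_def) blast
  then show ?thesis
    using bij_iff_perms by metis
qed

section \<open>Candidate antimorphisms and the choice of a branching arc\<close>

definition derangements :: "vert six list" where
  "derangements = filter (\<lambda>s. list_all (\<lambda>v. ap s v \<noteq> v) verts_list) perms"

text \<open>The 15 permutations of cycle type 2+2+2; \<open>four_cycles\<close> collects the 90 of
  type 4+2.\<close>

definition involutions :: "vert six list" where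
  "involutions = filter (\<lambda>s. list_all (\<lambda>v. ap s (ap s v) = v) verts_list) derangements"

definition four_cycles :: "vert six list" where
  "four_cycles = filter (\<lambda>s. list_ex (\<lambda>v. ap s (ap s v) \<noteq> v) verts_list \<and>
     list_all (\<lambda>v. ap s (ap s (ap s (ap s v))) = v) verts_list) derangements"

lemma verts_list_all: "list_all P verts_list \<longleftrightarrow> (\<forall>v. P v)"
  by (simp add: list_all_iff set_verts_list)

lemma candidate_props:
  assumes "s \<in> set (involutions @ four_cycles)"
  shows "ap s v \<noteq> v" "ap s (ap s (ap s (ap s v))) = v"
  using assms
  by (auto simp: involutions_def four_cycles_def derangements_def verts_list_all)

text \<open>Stops at the first permutation that is not yet hit. Since included arcs stay included,
  what is dropped remains hit in the whole subtree of the search.\<close>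

fun drop_hit :: "matrix \<Rightarrow> (vert \<times> vert) list \<Rightarrow> vert six list \<Rightarrow> vert six list" where
  "drop_hit M es [] = []"
| "drop_hit M es (s # ss) = (if hit s M es then drop_hit M es ss else s # ss)"

lemma drop_hit_subset: "set (drop_hit M es ss) \<subseteq> set ss"
  by (induction ss) auto

lemma drop_hit_Cons: "drop_hit M es ss = s # ss' \<Longrightarrow> \<not> hit s M es"
  by (induction ss) (auto split: if_splits)

text \<open>For an arc \<open>e\<close> and its image \<open>f\<close> with statuses
  \<open>x\<close> and \<open>y\<close>, an undecided arc of the pair is chosen provided that both
  can still be included. The number \<open>b\<close> is the budget left after the next inclusion, so
  two free arcs qualify only if it is positive.\<close>

fun pick :: "status \<Rightarrow> status \<Rightarrow> nat \<Rightarrow> vert \<times> vert \<Rightarrow> vert \<times> vert \<Rightarrow> (vert \<times> vert) option" where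
  "pick Free In b e f = Some e"
| "pick In Free b e f = Some f"
| "pick Free Free (Suc b) e f = Some e"
| "pick _ _ _ _ _ = None"

abbreviation or_else :: "'a option \<Rightarrow> 'a option \<Rightarrow> 'a option" (infixr \<open>or'_else\<close> 55) where
  "x or_else y \<equiv> (case x of Some e \<Rightarrow> Some e | None \<Rightarrow> y)"

fun pick_row :: "vert six \<Rightarrow> nat \<Rightarrow> vert \<Rightarrow> vert \<Rightarrow> status six \<Rightarrow> status six \<Rightarrow> (vert \<times> vert) option" where
  "pick_row (Six s0 s1 s2 s3 s4 s5) b u u' (Six a0 a1 a2 a3 a4 a5) r =
     pick a0 (ap r s0) b (u, U0) (u', s0) or_else pick a1 (ap r s1) b (u, U1) (u', s1) or_else
     pick a2 (ap r s2) b (u, U2) (u', s2) or_else pick a3 (ap r s3) b (u, U3) (u', s3) or_else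
     pick a4 (ap r s4) b (u, U4) (u', s4) or_else pick a5 (ap r s5) b (u, U5) (u', s5)"

definition row_arc :: "vert six \<Rightarrow> matrix \<Rightarrow> nat \<Rightarrow> vert \<Rightarrow> (vert \<times> vert) option" where
  "row_arc s M b u = pick_row s b u (ap s u) (ap M u) (ap M (ap s u))"

definition branch_arc :: "vert six \<Rightarrow> matrix \<Rightarrow> nat \<Rightarrow> (vert \<times> vert) option" where
  "branch_arc s M b = row_arc s M b U0 or_else row_arc s M b U1 or_else row_arc s M b U2 or_else
     row_arc s M b U3 or_else row_arc s M b U4 or_else row_arc s M b U5"

lemma pick_None:
  "pick x y b e f = None \<Longrightarrow> x = Out \<or> y = Out \<or> x = In \<and> y = In \<or> x = Free \<and> y = Free \<and> b = 0"
  by (cases x; cases y; cases b) simp_all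

lemma pick_Some: "pick x y b e f = Some g \<Longrightarrow> g = e \<and> x = Free \<or> g = f \<and> y = Free"
  by (cases x; cases y; cases b) auto

lemma row_arc_None:
  assumes "row_arc s M b u = None"
  shows "pick (status M u v) (status M (ap s u) (ap s v)) b (u, v) (ap s u, ap s v) = None"
  using assms
  by (cases s; cases "ap M u"; cases v)
     (simp_all add: row_arc_def status_def split: option.splits)

lemma row_arc_Some:
  assumes "row_arc s M b u = Some (x, y)"
  shows "status M x y = Free"
  using assms
  by (cases s; cases "ap M u")
     (auto simp: row_arc_def status_def split: option.splits dest!: pick_Some)

lemma branch_arc_None:
  assumes "branch_arc s M b = None"
  shows "pick (status M u v) (status M (ap s u) (ap s v)) b (u, v) (ap s u, ap s v) = None"
proof -
  have "row_arc s M b u = None"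
    using assms by (cases u) (simp_all add: branch_arc_def split: option.splits)
  then show ?thesis by (rule row_arc_None)
qed

lemma branch_arc_Some: "branch_arc s M b = Some (x, y) \<Longrightarrow> status M x y = Free"
  by (auto simp: branch_arc_def split: option.splits dest: row_arc_Some)

fun fixing :: "vert \<Rightarrow> vert \<Rightarrow> vert six list \<Rightarrow> vert six list" where
  "fixing u v [] = []"
| "fixing u v (s # ss) =
     (if ap s u = u \<and> ap s v = v then s # fixing u v ss else fixing u v ss)"

lemma set_fixing: "set (fixing u v G) = {s \<in> set G. ap s u = u \<and> ap s v = v}"
  by (induction G) auto

fun orbit :: "vert \<Rightarrow> vert \<Rightarrow> vert six list \<Rightarrow> (vert \<times> vert) list" where
  "orbit u v [] = []"
| "orbit u v (s # ss) = (ap s u, ap s v) # orbit u v ss"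

lemma set_orbit: "set (orbit u v G) = (\<lambda>p. (p u, p v)) ` ap ` set G"
  by (induction G) auto

text \<open>The digraphs of \<open>five_digraphs\<close> in the same order, labelled so that each
  contains both arcs between \<open>U0\<close> and \<open>U1\<close>, as \<open>embeds\<close>
  presupposes.\<close>

definition exceptional :: "(vert \<times> vert) list list" where
  "exceptional =
    [[(U0, U1), (U1, U0), (U0, U2), (U1, U2), (U2, U0), (U2, U1), (U3, U4), (U4, U5)],
     [(U0, U1), (U1, U0), (U0, U2), (U1, U2), (U2, U0), (U2, U1), (U4, U3), (U4, U5)],
     [(U0, U1), (U1, U0), (U0, U2), (U1, U2), (U2, U0), (U2, U1), (U3, U4), (U5, U4)],
     [(U0, U1), (U1, U0), (U2, U3), (U3, U4), (U4, U2), (U5, U2), (U5, U3), (U5, U4)],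
     [(U0, U1), (U1, U0), (U3, U2), (U4, U3), (U2, U4), (U2, U5), (U3, U5), (U4, U5)]]"

lemma exceptional_embeds_iff:
  "A \<in> set exceptional \<Longrightarrow> embeds A B \<longleftrightarrow> (\<exists>p. bij p \<and> act p (set A) \<subseteq> set B)"
  by (rule embeds_iff) (auto simp: exceptional_def)

lemma card_exceptional: "A \<in> set exceptional \<Longrightarrow> card (set A) = 8"
  by (auto simp: exceptional_def)

definition listed :: "(vert \<times> vert) list \<Rightarrow> bool" where
  "listed es \<longleftrightarrow> list_ex (\<lambda>A. embeds A es) exceptional"

text \<open>
  A completable digraph avoids, for some \<open>s\<close>, all pairs consisting of an arc and its image
  under \<open>s\<close>. The search therefore branches on an arc of such a pair for the first \<open>s\<close> of which
  no pair has been included yet. \<open>M\<close> records the decisions, \<open>es\<close> the included arcs, and \<open>b\<close>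
  the number of arcs still to be included; \<open>G\<close> is the pointwise stabilizer of \<open>es\<close>, so
  that excluding an arc excludes its whole orbit under \<open>G\<close>. The first argument is fuel: at most 8
  inclusions and 30 exclusions occur.
\<close>

fun search :: "nat \<Rightarrow> matrix \<Rightarrow> (vert \<times> vert) list \<Rightarrow> nat \<Rightarrow> vert six list \<Rightarrow> vert six list \<Rightarrow> bool" where
  "search 0 M es b G ss = False"
| "search (Suc n) M es b G ss = (case drop_hit M es ss of
     [] \<Rightarrow> (case b of 0 \<Rightarrow> listed es | Suc b' \<Rightarrow> False)
   | s # ss' \<Rightarrow> (case b of 0 \<Rightarrow> True | Suc b' \<Rightarrow> (case branch_arc s M b' of
       None \<Rightarrow> True
     | Some (u, v) \<Rightarrow>
         search n (set_status M u v In) ((u, v) # es) b' (fixing u v G) (s # ss') \<and>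
         search n (set_all Out (orbit u v G) M) es b G (s # ss'))))"

section \<open>Soundness of the search\<close>

definition stabilizer :: "(vert \<times> vert) list \<Rightarrow> (vert \<Rightarrow> vert) set" where
  "stabilizer es = {p. bij p \<and> (\<forall>u v. (u, v) \<in> set es \<longrightarrow> p u = u \<and> p v = v)}"

text \<open>Because the excluded arcs form a union of orbits of the stabilizer, moving a digraph by
  a stabilizer element violates no earlier decision.\<close>

definition invariant :: "matrix \<Rightarrow> (vert \<times> vert) list \<Rightarrow> vert six list \<Rightarrow> bool" where
  "invariant M es G \<longleftrightarrow> ap ` set G = stabilizer es \<and>
     (\<forall>u v. status M u v = In \<longleftrightarrow> (u, v) \<in> set es) \<and>
     (\<forall>p \<in> stabilizer es. \<forall>u v. status M (p u) (p v) = Out \<longleftrightarrow> status M u v = Out)"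

definition admits :: "matrix \<Rightarrow> (vert \<times> vert) list \<Rightarrow> nat \<Rightarrow> vert rel \<Rightarrow> bool" where
  "admits M es b D \<longleftrightarrow> set es \<subseteq> D \<and> (\<forall>(u, v) \<in> D. status M u v \<noteq> Out) \<and>
     card D = card (set es) + b"

definition solved :: "vert rel \<Rightarrow> bool" where
  "solved D \<longleftrightarrow> extendable D \<or> (\<exists>A \<in> set exceptional. \<exists>p. bij p \<and> D = act p (set A))"

lemma solved_act:
  assumes p: "bij p" and "solved (act p D)"
  shows "solved D"
  using assms(2) unfolding solved_def extendable_act[OF p]
proof (elim disjE bexE exE conjE)
  fix A q
  assume A: "A \<in> set exceptional" and q: "bij q" "act p D = act q (set A)"
  then have "D = act (inv p \<circ> q) (set A)"
    by (metis act_comp act_inv(1) p)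
  then show "extendable D \<or> (\<exists>A \<in> set exceptional. \<exists>p. bij p \<and> D = act p (set A))"
    using A bij_comp[OF q(1) bij_imp_bij_inv[OF p]] by blast
qed simp

text \<open>Both arc sets have eight elements, so an embedded exceptional digraph exhausts
  \<open>es\<close>.\<close>

lemma listed_solved:
  assumes "listed es" "card (set es) = 8"
  shows "solved (set es)"
proof -
  obtain A p where A: "A \<in> set exceptional" and p: "bij p" "act p (set A) \<subseteq> set es"
    using assms(1) by (auto simp: listed_def list_ex_iff exceptional_embeds_iff)
  have "act p (set A) = set es"
    using card_subset_eq[OF _ p(2)] A assms(2) by (simp add: card_act[OF p(1)] card_exceptional)
  then show ?thesis
    unfolding solved_def using A p(1) by blast
qed

lemma stabilizer_comp: "p \<in> stabilizer es \<Longrightarrow> q \<in> stabilizer es \<Longrightarrow> p \<circ> q \<in> stabilizer es"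
  by (simp add: stabilizer_def bij_comp)

lemma stabilizer_inv: "p \<in> stabilizer es \<Longrightarrow> inv p \<in> stabilizer es"
  by (simp add: stabilizer_def bij_imp_bij_inv bij_is_inj inv_f_eq)

lemma stabilizer_bij: "p \<in> stabilizer es \<Longrightarrow> bij p"
  by (simp add: stabilizer_def)

lemma stabilizer_fixes: "p \<in> stabilizer es \<Longrightarrow> (u, v) \<in> set es \<Longrightarrow> p u = u \<and> p v = v"
  by (auto simp: stabilizer_def)

lemma stabilizer_orbit:
  assumes "p \<in> stabilizer es"
  shows "(\<exists>q \<in> stabilizer es. (p x, p y) = (q u, q v)) \<longleftrightarrow> (\<exists>q \<in> stabilizer es. (x, y) = (q u, q v))"
proof
  assume "\<exists>q \<in> stabilizer es. (p x, p y) = (q u, q v)"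
  then obtain q where q: "q \<in> stabilizer es" "p x = q u" "p y = q v" by blast
  then have "x = (inv p \<circ> q) u" "y = (inv p \<circ> q) v"
    using bij_is_inj[OF stabilizer_bij[OF assms]] by (metis comp_apply inv_f_f)+
  then show "\<exists>q \<in> stabilizer es. (x, y) = (q u, q v)"
    using stabilizer_comp[OF stabilizer_inv[OF assms] q(1)] by blast
next
  assume "\<exists>q \<in> stabilizer es. (x, y) = (q u, q v)"
  then obtain q where "q \<in> stabilizer es" "x = q u" "y = q v" by blast
  then show "\<exists>q \<in> stabilizer es. (p x, p y) = (q u, q v)"
    using stabilizer_comp[OF assms] by (metis comp_apply)
qed

text \<open>The smaller stabilizer fixes \<open>u\<close> and \<open>v\<close>, so it leaves the
  changed entry in place, and the old invariant covers all other entries.\<close>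

lemma invariant_include:
  assumes inv: "invariant M es G" and free: "status M u v = Free"
  shows "invariant (set_status M u v In) ((u, v) # es) (fixing u v G)"
proof -
  have sub: "stabilizer ((u, v) # es) = {p \<in> stabilizer es. p u = u \<and> p v = v}"
    by (auto simp: stabilizer_def)
  have "p x = u \<longleftrightarrow> x = u" "p x = v \<longleftrightarrow> x = v" if "p \<in> stabilizer ((u, v) # es)" for p x
    using that stabilizer_bij[OF that] unfolding sub by (auto simp: bij_def inj_def)
  moreover have "ap ` set (fixing u v G) = stabilizer ((u, v) # es)"
    using inv unfolding sub by (auto simp: invariant_def set_fixing)
  moreover have "status M (p x) (p y) = Out \<longleftrightarrow> status M x y = Out"
    if "p \<in> stabilizer ((u, v) # es)" for p x y
    using that inv unfolding sub invariant_def by blast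
  ultimately show ?thesis
    using inv unfolding invariant_def by (simp add: status_set_status) blast
qed

text \<open>The orbit is stable under the stabilizer, and it misses \<open>es\<close>: arcs of
  \<open>es\<close> are fixed, so one of them in the orbit would be the free arc itself.\<close>

lemma invariant_exclude:
  assumes inv: "invariant M es G" and free: "status M u v = Free"
  shows "invariant (set_all Out (orbit u v G) M) es G"
proof -
  have orb: "(x, y) \<in> set (orbit u v G) \<longleftrightarrow> (\<exists>q \<in> stabilizer es. (x, y) = (q u, q v))" for x y
    using inv by (simp only: invariant_def set_orbit) blast
  have "(x, y) \<notin> set (orbit u v G)" if "(x, y) \<in> set es" for x y
  proof
    assume "(x, y) \<in> set (orbit u v G)"
    then obtain q where q: "q \<in> stabilizer es" "x = q u" "y = q v"
      by (auto simp: orb)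
    then have "x = u" "y = v"
      using stabilizer_fixes[OF q(1) that] bij_is_inj[OF stabilizer_bij[OF q(1)]]
      by (metis inj_eq)+
    then show False
      using that inv free unfolding invariant_def by (metis status.distinct(3))
  qed
  moreover have "(p x, p y) \<in> set (orbit u v G) \<longleftrightarrow> (x, y) \<in> set (orbit u v G)"
    if "p \<in> stabilizer es" for p x y
    using stabilizer_orbit[OF that] by (simp add: orb)
  ultimately show ?thesis
    using inv unfolding invariant_def by (simp add: status_set_all) blast
qed

lemma admits_include:
  assumes "admits M es (Suc b) D" "(u, v) \<in> D" "(u, v) \<notin> set es"
  shows "admits (set_status M u v In) ((u, v) # es) b D"
  using assms by (auto simp: admits_def status_set_status)

lemma admits_exclude:
  assumes "admits M es b D" "\<And>x y. (x, y) \<in> set (orbit u v G) \<Longrightarrow> (x, y) \<notin> D"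
  shows "admits (set_all Out (orbit u v G) M) es b D"
  using assms by (auto simp: admits_def status_set_all)

text \<open>This justifies the symmetry pruning: \<open>p\<close> fixes the included arcs, permutes
  the excluded ones and preserves the number of arcs.\<close>

lemma admits_act_inv:
  assumes "invariant M es G" "p \<in> stabilizer es" "admits M es b D"
  shows "admits M es b (act (inv p) D)"
proof -
  have p: "bij p"
    by (rule stabilizer_bij[OF assms(2)])
  have mem: "(x, y) \<in> act (inv p) D \<longleftrightarrow> (p x, p y) \<in> D" for x y
    using act_mem[OF p, of x y "act (inv p) D"] by (simp add: act_inv[OF p])
  then show ?thesis
    using assms stabilizer_fixes[OF assms(2)] card_act[OF bij_imp_bij_inv[OF p]]
    by (fastforce simp: admits_def invariant_def)
qed

text \<open>Of a conflicting pair in \<open>D\<close> no arc is excluded and not both are included.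
  Without a branching arc both are then free with a single inclusion left, so they would coincide,
  although \<open>s\<close> has no fixed vertex. If \<open>b = 0\<close>, then \<open>D\<close> is
  \<open>set es\<close>, where \<open>s\<close> has no conflict.\<close>

lemma no_branch_solved:
  assumes s: "s \<in> set (involutions @ four_cycles)"
    and inv: "invariant M es G" and D: "admits M es b D" "irrefl D"
    and nhit: "\<not> hit s M es"
    and stuck: "\<And>b'. b = Suc b' \<Longrightarrow> branch_arc s M b' = None"
  shows "solved D"
proof -
  have cases: "e \<in> set es \<or> b \<noteq> 0" if "e \<in> D" for e
    using that D(1) card_subset_eq[of D "set es"] by (auto simp: admits_def)
  have "conflict_free (ap s) D"
    unfolding conflict_free_def
  proof (clarify)
    fix u v
    assume uv: "(u, v) \<in> D" "(ap s u, ap s v) \<in> D"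
    have In: "status M x y = In \<longleftrightarrow> (x, y) \<in> set es" for x y
      using inv by (simp add: invariant_def)
    have nconf: "\<not> (status M u v = In \<and> status M (ap s u) (ap s v) = In)"
      using nhit by (auto simp: hit_iff In)
    obtain b' where b': "b = Suc b'"
      using cases[OF uv(1)] cases[OF uv(2)] nconf In by (cases b) auto
    then have free: "status M u v = Free" "status M (ap s u) (ap s v) = Free" "b' = 0"
      using pick_None[OF branch_arc_None[OF stuck[OF b'], of u v]] D(1) uv nconf
      by (auto simp: admits_def)
    then have "(u, v) \<notin> set es" "(ap s u, ap s v) \<notin> set es"
      by (simp_all flip: In)
    then have "{(u, v), (ap s u, ap s v)} \<subseteq> D - set es" "card (D - set es) = 1"
      using uv D(1) b' free(3) by (auto simp: admits_def card_Diff_subset)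
    then have "(u, v) = (ap s u, ap s v)"
      by (metis card_1_singletonE insert_subset singletonD)
    then show False
      using candidate_props(1)[OF s, of u] by simp
  qed
  then show ?thesis
    unfolding solved_def
    using extendable_if_conflict_free[OF candidate_props[OF s]] D(2) by blast
qed

text \<open>Induction on the fuel. If \<open>D\<close> meets the stabilizer orbit of the branching
  arc, a relabelled \<open>D\<close> falls under the inclusion branch; otherwise \<open>D\<close>
  itself falls under the exclusion branch.\<close>

lemma search_sound:
  assumes "search n M es b G ss" "set ss \<subseteq> set (involutions @ four_cycles)"
    and "invariant M es G" "admits M es b D" "irrefl D" "card D = 8"
  shows "solved D"
  using assms
proof (induction n arbitrary: M es b G ss D)
  case (Suc n)
  note inv = Suc.prems(3) and adm = Suc.prems(4)
  show ?case
  proof (cases "drop_hit M es ss")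
    case Nil
    \<comment> \<open>The search fails when every candidate is hit before the budget is used up, so
      its success leaves only \<open>b = 0\<close>.\<close>
    then have "b = 0" "listed es"
      using Suc.prems(1) by (auto split: nat.splits)
    moreover from this have "D = set es"
      using adm card_subset_eq[of D "set es"] by (auto simp: admits_def)
    ultimately show ?thesis
      using listed_solved Suc.prems(6) by blast
  next
    case (Cons s ss')
    have ss: "set (s # ss') \<subseteq> set (involutions @ four_cycles)"
      using drop_hit_subset[of M es ss] Suc.prems(2) unfolding Cons by blast
    then have s: "s \<in> set (involutions @ four_cycles)"
      by simp
    note no_branch = no_branch_solved[OF s inv adm Suc.prems(5) drop_hit_Cons[OF Cons]]
    show ?thesis
    proof (cases "\<exists>b' u v. b = Suc b' \<and> branch_arc s M b' = Some (u, v)")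
      \<comment> \<open>Either the budget is exhausted or there is no arc to branch on.\<close>
      case False
      then show ?thesis
        by (intro no_branch) (metis not_None_eq surj_pair)
    next
      case True
      then obtain b' u v where b: "b = Suc b'" "branch_arc s M b' = Some (u, v)"
        by blast
      let ?M1 = "set_status M u v In" and ?M2 = "set_all Out (orbit u v G) M"
      have search: "search n ?M1 ((u, v) # es) b' (fixing u v G) (s # ss')"
        "search n ?M2 es b G (s # ss')"
        using Suc.prems(1) Cons b by simp_all
      have free: "status M u v = Free"
        by (rule branch_arc_Some[OF b(2)])
      have notin: "(u, v) \<notin> set es"
        using inv free unfolding invariant_def by (metis status.distinct(3))
      have incl: "solved E"
        if "admits M es b E" "irrefl E" "card E = 8" "(u, v) \<in> E" for E
        using Suc.IH[OF search(1) ss invariant_include[OF inv free] admits_include]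
          that notin b(1) by blast
      show ?thesis
      proof (cases "\<exists>p \<in> stabilizer es. (p u, p v) \<in> D")
        case True
        then obtain p where p: "p \<in> stabilizer es" "(p u, p v) \<in> D" by blast
        have bij: "bij p" "bij (inv p)"
          using stabilizer_bij[OF p(1)] by (simp_all add: bij_imp_bij_inv)
        have "(u, v) \<in> act (inv p) D"
          using act_mem[OF bij(2), of "p u" "p v" D] p(2) bij_is_inj[OF bij(1)] by simp
        then have "solved (act (inv p) D)"
          using incl admits_act_inv[OF inv p(1) adm] Suc.prems(5,6)
          by (simp add: irrefl_act[OF bij(2)] card_act[OF bij(2)])
        then show ?thesis
          by (rule solved_act[OF bij(2)])
      next
        case False
        then have "admits ?M2 es b D"
          using inv by (intro admits_exclude[OF adm]) (simp only: invariant_def set_orbit, blast)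
        then show ?thesis
          using Suc.IH[OF search(2) ss invariant_exclude[OF inv free]] Suc.prems(5,6) by blast
      qed
    qed
  qed
qed simp

section \<open>All arc sets with eight arcs\<close>

definition loops :: "(vert \<times> vert) list" where
  "loops = [(U0, U0), (U1, U1), (U2, U2), (U3, U3), (U4, U4), (U5, U5)]"

lemma set_loops: "(u, v) \<in> set loops \<longleftrightarrow> u = v"
  by (cases u; cases v) (simp_all add: loops_def)

text \<open>Loops are excluded at the outset, so that no branching arc is a loop.\<close>

definition start :: matrix where
  "start = set_all Out loops (const_matrix Free)"

lemma status_start: "status start u v = (if u = v then Out else Free)"
  by (simp add: start_def status_set_all set_loops status_const_matrix)

text \<open>Fuel 39 covers 8 inclusions, 30 exclusions and the final leaf; \<open>perms\<close>
  represents the stabilizer of the empty list.\<close>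

lemma search_succeeds: "search 39 start [] 8 perms (involutions @ four_cycles)"
  by code_simp

lemma solved_eight:
  assumes "irrefl D" "card D = 8"
  shows "solved D"
proof (rule search_sound[OF search_succeeds subset_refl _ _ assms])
  have "ap ` set perms = stabilizer []"
    by (simp add: stabilizer_def bij_iff_perms set_eq_iff image_iff)
  moreover have "status start (p u) (p v) = Out \<longleftrightarrow> status start u v = Out"
    if "p \<in> stabilizer []" for p u v
    using inj_eq[OF bij_is_inj[OF stabilizer_bij[OF that]]] by (simp add: status_start)
  ultimately show "invariant start [] perms"
    by (simp add: invariant_def status_start)
  show "admits start [] 8 D"
    using assms by (auto simp: admits_def status_start irrefl_def)
qed

section \<open>Noncompletability and minimality\<close>

definition iterate3 :: "vert six \<Rightarrow> vert six" where
  "iterate3 s = (let f = (\<lambda>v. ap s (ap s (ap s v))) in Six (f U0) (f U1) (f U2) (f U3) (f U4) (f U5))"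

definition iterate5 :: "vert six \<Rightarrow> vert six" where
  "iterate5 s = (let f = (\<lambda>v. ap s (ap s (ap s (ap s (ap s v))))) in
     Six (f U0) (f U1) (f U2) (f U3) (f U4) (f U5))"

definition blocked :: "matrix \<Rightarrow> (vert \<times> vert) list \<Rightarrow> vert six \<Rightarrow> bool" where
  "blocked M A s \<longleftrightarrow> list_ex (\<lambda>(u, v). ap s u = u \<and> ap s v = v) arcs_list \<or> hit s M A"

lemma iterate3: "ap (iterate3 s) v = ap s (ap s (ap s v))"
  by (cases v) (simp_all add: iterate3_def Let_def)

lemma iterate5: "ap (iterate5 s) v = ap s (ap s (ap s (ap s (ap s v))))"
  by (cases v) (simp_all add: iterate5_def Let_def)

text \<open>An odd number of membership reversals is a reversal; injectivity keeps the two vertices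
  distinct in between.\<close>

lemma antimorphism_iterates:
  assumes "antimorphism (ap s) S"
  shows "antimorphism (ap (iterate3 s)) S" "antimorphism (ap (iterate5 s)) S"
proof -
  have bij: "bij (ap s)" and flip: "\<And>u v. u \<noteq> v \<Longrightarrow> (ap s u, ap s v) \<in> S \<longleftrightarrow> (u, v) \<notin> S"
    using assms by (auto simp: antimorphism_def)
  have eq: "ap s u = ap s v \<longleftrightarrow> u = v" for u v
    by (rule inj_eq[OF bij_is_inj[OF bij]])
  have "ap (iterate3 s) = ap s \<circ> ap s \<circ> ap s"
    "ap (iterate5 s) = ap s \<circ> ap s \<circ> ap s \<circ> ap s \<circ> ap s"
    by (simp_all add: fun_eq_iff iterate3 iterate5)
  then show "antimorphism (ap (iterate3 s)) S" "antimorphism (ap (iterate5 s)) S"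
    using bij by (auto simp: antimorphism_def flip eq intro!: bij_comp)
qed

lemma not_blocked:
  assumes "antimorphism (ap s) S" "set A \<subseteq> S" "irrefl S"
  shows "\<not> blocked (matrix A) A s"
proof
  have flip: "(ap s u, ap s v) \<in> S \<longleftrightarrow> (u, v) \<notin> S" if "u \<noteq> v" for u v
    using assms(1) that by (simp add: antimorphism_def)
  assume "blocked (matrix A) A s"
  then consider u v where "u \<noteq> v" "ap s u = u" "ap s v = v"
    | u v where "(u, v) \<in> set A" "(ap s u, ap s v) \<in> set A"
    by (auto simp: blocked_def list_ex_iff set_arcs_list hit_iff status_matrix)
  then show False
  proof cases
    case 1
    then show False using flip[of u v] by simp
  next
    case 2
    then show False using flip[of u v] assms(2,3) by (auto simp: irrefl_def)
  qed
qed

text \<open>A cube fixes the points of a 3-cycle and turns a 6-cycle into type 2+2+2; a fifth power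
  fixes the points of a 5-cycle. Other permutations with at most one fixed point have type 2+2+2 or
  4+2, and there the obstruction is an arc of \<open>A\<close> mapped to an arc of
  \<open>A\<close>.\<close>

lemma all_blocked:
  "list_all (\<lambda>A. list_all (\<lambda>s. blocked (matrix A) A s \<or> blocked (matrix A) A (iterate3 s) \<or>
     blocked (matrix A) A (iterate5 s)) perms) exceptional"
  by code_simp

lemma exceptional_not_extendable:
  assumes "A \<in> set exceptional"
  shows "\<not> extendable (set A)"
proof
  assume "extendable (set A)"
  then obtain \<sigma> S where S: "irrefl S" "set A \<subseteq> S" "antimorphism \<sigma> S"
    by (auto simp: extendable_def)
  then obtain s where s: "s \<in> set perms" "\<sigma> = ap s"
    using bij_iff_perms by (auto simp: antimorphism_def)
  then have "blocked (matrix A) A s \<or> blocked (matrix A) A (iterate3 s) \<or>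
      blocked (matrix A) A (iterate5 s)"
    using all_blocked assms by (auto simp: list_all_iff)
  then show False
    using S s(2) not_blocked antimorphism_iterates by metis
qed

text \<open>Source of arc-minimality: each deletion leaves at least one of the 105 candidates
  without a conflict.\<close>

lemma exceptional_minus_arc_hit:
  "list_all (\<lambda>A. list_all (\<lambda>e. list_ex (\<lambda>s. \<not> hit s (matrix (removeAll e A)) (removeAll e A))
     (involutions @ four_cycles)) A) exceptional"
  by code_simp

lemma exceptional_minus_arc_extendable:
  assumes "A \<in> set exceptional" "e \<in> set A"
  shows "extendable (set A - {e})"
proof -
  obtain s where s: "s \<in> set (involutions @ four_cycles)"
    and "\<not> hit s (matrix (removeAll e A)) (removeAll e A)"
    using assms exceptional_minus_arc_hit unfolding list_all_iff list_ex_iff by blast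
  then have "conflict_free (ap s) (set (removeAll e A))"
    by (intro conflict_free_if_not_hit)
  moreover have "irrefl (set (removeAll e A))"
    using assms(1) by (auto simp: exceptional_def irrefl_def)
  ultimately have "extendable (set (removeAll e A))"
    using extendable_if_conflict_free[OF candidate_props[OF s]] by blast
  then show ?thesis
    by simp
qed

lemma irrefl_exceptional: "A \<in> set exceptional \<Longrightarrow> irrefl (set A)"
  by (auto simp: exceptional_def irrefl_def)

text \<open>Pairwise nonisomorphism, as an isomorphism is in particular an embedding.\<close>

lemma exceptional_not_embeds:
  "list_all (\<lambda>A. list_all (\<lambda>B. A = B \<or> \<not> embeds A B) exceptional) exceptional"
  by code_simp

lemma exceptional_act_eq:
  assumes "A \<in> set exceptional" "B \<in> set exceptional" "bij p" "set B = act p (set A)"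
  shows "A = B"
proof -
  have "embeds A B"
    using assms by (auto simp: exceptional_embeds_iff)
  then show ?thesis
    using exceptional_not_embeds assms(1,2) by (auto simp: list_all_iff)
qed

lemma distinct_exceptional: "distinct exceptional"
  by (simp add: exceptional_def)

section \<open>Counting labelled copies\<close>

text \<open>The orbit of \<open>A\<close> under the symmetric group.\<close>

definition labellings :: "vert rel \<Rightarrow> vert rel set" where
  "labellings A = (\<lambda>p. act p A) ` {p. bij p}"

lemma card_bij_vert: "card {p :: vert \<Rightarrow> vert. bij p} = 720"
proof -
  have "{p :: vert \<Rightarrow> vert. bij p} = {p. p permutes UNIV}"
    by (auto intro: permutes_bij bij_imp_permutes)
  then show ?thesis
    using card_permutations[of "UNIV :: vert set" 6] card_vert by (simp add: fact_numeral)
qed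

text \<open>Orbit-stabilizer theorem: the fibre of \<open>\<lambda>p. act p A\<close> over
  \<open>act q A\<close> is the coset of the automorphism group obtained by composing with
  \<open>q\<close> on the left.\<close>

lemma card_labellings:
  "card (labellings A) * card {p. bij p \<and> act p A = A} = 720"
proof -
  let ?P = "{p :: vert \<Rightarrow> vert. bij p}"
  have "card {p \<in> ?P. act p A = B} = card {p. bij p \<and> act p A = A}" if "B \<in> labellings A" for B
  proof -
    obtain q where q: "bij q" "B = act q A"
      using \<open>B \<in> labellings A\<close> by (auto simp: labellings_def)
    have "bij_betw ((\<circ>) q) {p. bij p \<and> act p A = A} {p \<in> ?P. act p A = B}"
    proof (rule bij_betw_byWitness[where f' = "(\<circ>) (inv q)"])
      show "(\<circ>) (inv q) ` {p \<in> ?P. act p A = B} \<subseteq> {p. bij p \<and> act p A = A}"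
        using q by (auto simp: bij_comp bij_imp_bij_inv act_inv simp flip: act_comp)
      show "(\<circ>) q ` {p. bij p \<and> act p A = A} \<subseteq> {p \<in> ?P. act p A = B}"
        using q by (auto simp: bij_comp simp flip: act_comp)
    qed (use q(1) in \<open>auto simp: o_assoc[symmetric] fun_eq_iff bij_is_inj bij_is_surj surj_f_inv_f\<close>)
    then show ?thesis
      by (rule bij_betw_same_card[symmetric])
  qed
  moreover have "card ?P = (\<Sum>B \<in> labellings A. card {p \<in> ?P. act p A = B})"
    unfolding labellings_def card_eq_sum by (rule sum.image_gen) simp
  ultimately show ?thesis
    by (simp add: card_bij_vert)
qed

text \<open>A permutation preserves the number of arcs, so mapping \<open>set A\<close> into itself
  already makes it an automorphism.\<close>

lemma automorphisms_conv:
  "{p. bij p \<and> act p (set A) = set A} = ap ` set (filter (\<lambda>s. maps_into s (matrix A) A) perms)"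
proof -
  have "bij p \<and> act p (set A) = set A \<longleftrightarrow> bij p \<and> act p (set A) \<subseteq> set A" for p
    using card_subset_eq[of "set A" "act p (set A)"] card_act[of p "set A"] by auto
  then show ?thesis
    by (auto simp: maps_into_matrix perms_iff image_iff) (metis bij_iff_perms)
qed

text \<open>The complete component contributes 6 or 2 automorphisms, and the other components have
  1, 2, 2, 3 and 3.\<close>

lemma card_automorphisms:
  "map (\<lambda>A. card (set (filter (\<lambda>s. maps_into s (matrix A) A) perms))) exceptional = [6, 12, 12, 6, 6]"
  by code_simp

lemma sum_card_labellings: "(\<Sum>A \<in> set exceptional. card (labellings (set A))) = 480"
proof -
  have "card (labellings (set A)) = 720 div card (set (filter (\<lambda>s. maps_into s (matrix A) A) perms))"
    (is "_ = 720 div card ?F") for A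
  proof -
    have "card (ap ` ?F) = card ?F"
      by (rule card_image) (simp add: inj_on_def ap_inject)
    then have "card (labellings (set A)) * card ?F = 720"
      using card_labellings[of "set A"] by (simp only: automorphisms_conv)
    \<comment> \<open>The product is nonzero, hence so is \<open>card ?F\<close>, and the division
      is legitimate.\<close>
    then show ?thesis
      by (metis mult_0_right nonzero_mult_div_cancel_right zero_neq_numeral)
  qed
  then have "(\<Sum>A \<in> set exceptional. card (labellings (set A))) =
      sum_list (map (\<lambda>c. 720 div c)
        (map (\<lambda>A. card (set (filter (\<lambda>s. maps_into s (matrix A) A) perms))) exceptional))"
    by (simp add: sum.distinct_set_conv_list[OF distinct_exceptional] o_def)
  also have "\<dots> = 480"
    unfolding card_automorphisms by simp
  finally show ?thesis .
qed

lemma not_extendable_iff: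
  assumes "irrefl D" "card D = 8"
  shows "\<not> extendable D \<longleftrightarrow> (\<exists>A \<in> set exceptional. D \<in> labellings (set A))"
  using solved_eight[OF assms] exceptional_not_extendable extendable_act
  by (auto simp: solved_def labellings_def)

lemma card_not_extendable: "card {D. irrefl D \<and> card D = 8 \<and> \<not> extendable D} = 480"
proof -
  have "irrefl D \<and> card D = 8" if "A \<in> set exceptional" "D \<in> labellings (set A)" for A D
    using that by (auto simp: labellings_def irrefl_act irrefl_exceptional card_act card_exceptional)
  then have "{D. irrefl D \<and> card D = 8 \<and> \<not> extendable D} =
      (\<Union>A \<in> set exceptional. labellings (set A))"
    using not_extendable_iff by blast
  also have "card \<dots> = (\<Sum>A \<in> set exceptional. card (labellings (set A)))"
  proof (intro card_UN_disjoint ballI impI)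
    fix A B
    assume AB: "A \<in> set exceptional" "B \<in> set exceptional" "A \<noteq> B"
    show "labellings (set A) \<inter> labellings (set B) = {}"
    proof (rule ccontr)
      \<comment> \<open>A common labelled copy would make the two digraphs isomorphic.\<close>
      assume "\<not> ?thesis"
      then obtain p q where pq: "bij p" "bij q" "act p (set A) = act q (set B)"
        by (auto simp: labellings_def)
      then have "set B = act (inv q \<circ> p) (set A)"
        by (metis act_comp act_inv(1))
      then show False
        using exceptional_act_eq[OF AB(1,2) bij_comp[OF pq(1) bij_imp_bij_inv[OF pq(2)]]] AB(3)
        by blast
    qed
  qed simp_all
  finally show ?thesis
    by (simp add: sum_card_labellings)
qed

section \<open>The five digraphs\<close>

text \<open>The vertices of the first component are \<open>U0, U1, U2\<close> or \<open>U0, U1\<close>.\<close>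

definition frame :: "(vert \<times> vert) list \<Rightarrow> vert \<Rightarrow> nat + nat" where
  "frame A = ap (if (U0, U2) \<in> set A
     then Six (Inl 0) (Inl 1) (Inl 2) (Inr 0) (Inr 1) (Inr 2)
     else Six (Inl 0) (Inl 1) (Inr 0) (Inr 1) (Inr 2) (Inr 3))"

definition realize :: "(vert \<times> vert) list \<Rightarrow> (nat + nat) pair_pre_digraph" where
  "realize A = copy (frame A) (set A)"

lemma inj_frame: "inj (frame A)"
  by (auto simp: frame_def inj_def all_vert)

lemma complete_dg_3: "complete_dg 3 =
    \<lparr> pverts = {0, 1, 2}, parcs = {(0, 1), (0, 2), (1, 0), (1, 2), (2, 0), (2, 1)} \<rparr>"
  by (auto simp: complete_dg_def less_Suc_eq numeral_eq_Suc)

lemma complete_dg_2: "complete_dg 2 = \<lparr> pverts = {0, 1}, parcs = {(0, 1), (1, 0)} \<rparr>"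
  by (auto simp: complete_dg_def less_Suc_eq numeral_eq_Suc)

lemma five_digraphs_conv: "five_digraphs = realize ` set exceptional"
proof -
  have "map realize exceptional =
    [complete_dg 3 \<uplus> P3, complete_dg 3 \<uplus> V3, complete_dg 3 \<uplus> Lambda3,
      complete_dg 2 \<uplus> T4_plus, complete_dg 2 \<uplus> T4_minus]"
    unfolding exceptional_def complete_dg_3 complete_dg_2
    by (auto simp: realize_def copy_def frame_def UNIV_vert disjoint_union_def
      P3_def V3_def Lambda3_def T4_plus_def T4_minus_def reverse_def Plus_def)
  then show ?thesis
    unfolding five_digraphs_def set_map[symmetric] by simp
qed

lemma realize_iso_iff:
  assumes "A \<in> set exceptional" "B \<in> set exceptional"
  shows "realize A \<simeq> realize B \<longleftrightarrow> A = B"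
  unfolding realize_def copy_iso_iff[OF inj_frame inj_frame irrefl_exceptional[OF assms(1)]]
  using exceptional_act_eq[OF assms] by (auto intro!: exI[of _ id] simp: act_id)

section \<open>Converses\<close>

lemma reverse_copy: "reverse (copy h A) = copy h (A\<inverse>)"
  by (rule copy_eqI) (auto simp: reverse_def)

lemma length_exceptional: "length exceptional = 5"
  by (simp add: exceptional_def)

lemma pair_digraph_realize: "A \<in> set exceptional \<Longrightarrow> pair_digraph (realize A)"
  unfolding realize_def by (rule pair_digraph_copy[OF inj_frame irrefl_exceptional])

text \<open>Reversal exchanges central source and central sink in the second and third digraph, and
  \<open>T4_plus\<close> and \<open>T4_minus\<close> in the last two.\<close>

lemma reverse_realize:
  "reverse (realize (exceptional ! 1)) = realize (exceptional ! 2)"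
  "reverse (realize (exceptional ! 3)) = realize (exceptional ! 4)"
  unfolding realize_def reverse_copy
  by (auto simp: exceptional_def frame_def intro!: arg_cong[where f = "copy _"])

lemma card_quotient: "card (five_digraphs // iso_or_converse) = 3"
proof -
  define e where "e i = realize (exceptional ! i)" for i
  let ?c = "\<lambda>i. iso_or_converse `` {e i}"
  have five: "five_digraphs = {e 0, e 1, e 2, e 3, e 4}"
    unfolding five_digraphs_conv e_def by (simp add: exceptional_def)
  have dg: "pair_digraph (e i)" if "i < 5" for i
    using that pair_digraph_realize by (simp add: e_def length_exceptional)
  have rev: "reverse (e 1) = e 2" "reverse (e 2) = e 1" "reverse (e 3) = e 4" "reverse (e 4) = e 3"
    using reverse_realize by (simp_all add: e_def) (metis reverse_reverse)+
  have iso: "e i \<simeq> e j \<longleftrightarrow> i = j" if "i < 5" "j < 5" for i j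
    using that
    by (simp add: e_def realize_iso_iff length_exceptional nth_eq_iff_index_eq distinct_exceptional)
  have class_eq: "?c i = ?c j \<longleftrightarrow> e i \<simeq> e j \<or> e i \<simeq> reverse (e j)"
    if "i < 5" "j < 5" for i j
    using eq_equiv_class_iff[OF equiv_iso_or_converse, of "e i" "e j"] dg[OF that(1)] dg[OF that(2)]
    by (simp add: iso_or_converse_def)
  have "five_digraphs // iso_or_converse = {?c 0, ?c 1, ?c 2, ?c 3, ?c 4}"
    unfolding five quotient_def by auto
  also have "\<dots> = {?c 0, ?c 1, ?c 3}"
    using class_eq[of 1 2] class_eq[of 3 4] by (auto simp: rev iso)
  \<comment> \<open>Only \<open>e 1\<close> and \<open>e 3\<close> get reversed in these
    comparisons; their converses lie in the list again, where isomorphic means equal.\<close>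
  also have "card \<dots> = 3"
    using class_eq[of 0 1] class_eq[of 0 3] class_eq[of 1 3] by (simp add: rev[unfolded One_nat_def] iso)
  finally show ?thesis .
qed

section \<open>From arc sets back to digraphs\<close>

lemma arc_minimal_realize:
  assumes "A \<in> set exceptional"
  shows "arc_minimal (realize A)"
proof -
  have "completable (delete_arc (realize A) a)" if "a \<in> parcs (realize A)" for a
  proof -
    obtain e where e: "e \<in> set A" "a = map_prod (frame A) (frame A) e"
      using \<open>a \<in> parcs (realize A)\<close> by (auto simp: realize_def)
    have "parcs (realize A) - {a} = map_prod (frame A) (frame A) ` (set A - {e})"
      using e prod.inj_map[OF inj_frame inj_frame, of A A]
      by (simp add: realize_def image_set_diff)
    then have "delete_arc (realize A) a = copy (frame A) (set A - {e})"
      by (simp add: delete_arc_def realize_def copy_def)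
    moreover have "irrefl (set A - {e})"
      using irrefl_exceptional[OF assms] by (simp add: irrefl_def)
    ultimately show ?thesis
      using exceptional_minus_arc_extendable[OF assms e(1)] completable_copy[OF inj_frame] by simp
  qed
  then show ?thesis
    using exceptional_not_extendable[OF assms] completable_copy[OF inj_frame irrefl_exceptional[OF assms]]
    by (simp add: arc_minimal_def realize_def)
qed

lemma noncompletable_iso_exceptional:
  fixes D :: "'a pair_pre_digraph"
  assumes "pair_digraph D" "card (pverts D) = 6" "card (parcs D) = 8" "\<not> completable D"
  shows "\<exists>A \<in> set exceptional. D \<simeq> realize A"
proof -
  obtain h :: "vert \<Rightarrow> 'a" where h: "inj h" "range h = pverts D"
    using frame_exists[OF assms(2)] by blast
  obtain B where B: "irrefl B" "D = copy h B"
    using copy_exists[OF assms(1) h] by blast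
  then have "card B = 8" "\<not> extendable B"
    using assms(3,4) card_copy(2)[OF h(1)] completable_copy[OF h(1)] by simp_all
  then obtain A p where A: "A \<in> set exceptional" and p: "bij p" "B = act p (set A)"
    using not_extendable_iff[OF B(1)] by (auto simp: labellings_def)
  have "realize A \<simeq> D"
    unfolding realize_def B(2) copy_iso_iff[OF inj_frame h(1) irrefl_exceptional[OF A]]
    using p by blast
  then show ?thesis
    using A iso_sym by blast
qed

text \<open>A fixed labelling \<open>h\<close> of \<open>V\<close> makes \<open>copy h\<close>
  injective with the required digraphs as image, which carries the count over from
  \<open>vert\<close>.\<close>

lemma card_noncompletable:
  fixes V :: "'a set"
  assumes "card V = 6"
  shows "card {D. pair_digraph D \<and> pverts D = V \<and> card (parcs D) = 8 \<and> \<not> completable D} = 480"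
    (is "card ?N = _")
proof -
  obtain h :: "vert \<Rightarrow> 'a" where h: "inj h" "range h = V"
    using frame_exists[OF assms] by blast
  have "?N = copy h ` {B. irrefl B \<and> card B = 8 \<and> \<not> extendable B}"
  proof (intro subset_antisym subsetI)
    fix D
    assume "D \<in> ?N"
    then obtain B where B: "irrefl B" "D = copy h B"
      using copy_exists[of D h] h by auto
    then show "D \<in> copy h ` {B. irrefl B \<and> card B = 8 \<and> \<not> extendable B}"
      using \<open>D \<in> ?N\<close> card_copy(2)[OF h(1), of B] completable_copy[OF h(1) B(1)] by auto
  next
    fix D
    assume "D \<in> copy h ` {B. irrefl B \<and> card B = 8 \<and> \<not> extendable B}"
    then show "D \<in> ?N"
      using card_copy(2)[OF h(1)] completable_copy[OF h(1)] pair_digraph_copy[OF h(1)] h(2) by auto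
  qed
  moreover have "inj (copy h)"
    by (simp add: inj_def copy_inject[OF h(1)])
  ultimately show ?thesis
    by (simp add: card_image inj_on_subset card_not_extendable)
qed

theorem theorem1p2:
  "(\<forall>E \<in> five_digraphs. pair_digraph E \<and> card (pverts E) = 6 \<and> card (parcs E) = 8 \<and>
       \<not> completable E) \<and>
   (\<forall>D :: 'a pair_pre_digraph.
       pair_digraph D \<and> card (pverts D) = 6 \<and> card (parcs D) = 8 \<and> \<not> completable D \<longrightarrow>
       (\<exists>E \<in> five_digraphs. D \<simeq> E)) \<and>
   card five_digraphs = 5 \<and>
   (\<forall>D \<in> five_digraphs. \<forall>E \<in> five_digraphs. D \<simeq> E \<longrightarrow> D = E) \<and>
   (\<forall>V :: 'a set. card V = 6 \<longrightarrow>
       card {D. pair_digraph D \<and> pverts D = V \<and> card (parcs D) = 8 \<and> \<not> completable D} = 480) \<and>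
   (\<forall>E \<in> five_digraphs. arc_minimal E) \<and>
   card (five_digraphs // iso_or_converse) = 3"
proof (intro conjI)
  have "pair_digraph (realize A) \<and> card (pverts (realize A)) = 6 \<and> card (parcs (realize A)) = 8 \<and>
      \<not> completable (realize A)" if "A \<in> set exceptional" for A
    using pair_digraph_realize[OF that] arc_minimal_realize[OF that] card_copy[OF inj_frame]
      card_exceptional[OF that] by (simp add: arc_minimal_def realize_def)
  then show "\<forall>E \<in> five_digraphs. pair_digraph E \<and> card (pverts E) = 6 \<and> card (parcs E) = 8 \<and>
      \<not> completable E"
    by (simp add: five_digraphs_conv)
  show "\<forall>D :: 'a pair_pre_digraph.
      pair_digraph D \<and> card (pverts D) = 6 \<and> card (parcs D) = 8 \<and> \<not> completable D \<longrightarrow>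
      (\<exists>E \<in> five_digraphs. D \<simeq> E)"
    using noncompletable_iso_exceptional by (auto simp: five_digraphs_conv)
  have inj: "inj_on realize (set exceptional)"
    by (rule inj_onI) (metis realize_iso_iff)
  have "card (set exceptional) = 5"
    using distinct_card[OF distinct_exceptional] by (simp add: length_exceptional)
  then show "card five_digraphs = 5"
    by (simp add: five_digraphs_conv card_image[OF inj])
  show "\<forall>D \<in> five_digraphs. \<forall>E \<in> five_digraphs. D \<simeq> E \<longrightarrow> D = E"
    by (auto simp: five_digraphs_conv realize_iso_iff)
  show "\<forall>V :: 'a set. card V = 6 \<longrightarrow>
      card {D. pair_digraph D \<and> pverts D = V \<and> card (parcs D) = 8 \<and> \<not> completable D} = 480"
    using card_noncompletable by blast
  show "\<forall>E \<in> five_digraphs. arc_minimal E"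
    by (simp add: five_digraphs_conv arc_minimal_realize)
  show "card (five_digraphs // iso_or_converse) = 3"
    by (rule card_quotient)
qed

end
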